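(* Let $\mathbb{E}_1,\mathbb{E}_2$ be Euclidean spaces, let $K\subset\mathbb{E}_2$ be a (nontrivial) closed, convex cone with $K\subset-K^\circ$, and let $F:\mathbb{E}_1\to\mathbb{E}_2^\bullet$ be proper, $K$-closed and $K$-convex. Assume that the following hold: (i) There is a nonempty set $L\subset K\cap\mathrm{rge}\,F$ such that $\mathrm{cl}(\mathrm{cone}\,L)=K$; (ii) For every $u\in L$, there exists a convex set $C^u\subset\mathrm{dom}\,F$ such that $F(C^u)\subset\mathbb{R}_+u$; (iii) For all $u\in L$ the function $f_u:=\langle u,F\rangle+\delta_{C^u}$ belongs to $\Gamma_0(C^u)$ and has no affine majorant on its domain. Then $K\text{-}\mathrm{epi}\,F=\overline{\mathrm{conv}}(\mathrm{gph}\,F)$. In particular, $K=\hat K_F$, the smallest closed convex cone with respect to which $F$ is both convex and closed.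
   Context: A Euclidean space is a finite-dimensional real inner product space. A cone is a nonempty set $K$ with $\lambda x\in K$ for all $\lambda\ge0$, $x\in K$; nontrivial means $K\ne\{0\}$. $K^\circ:=\{v : \langle u,v\rangle\le0\ \forall u\in K\}$. $\mathrm{cone}\,L$ is the convex conical hull, $\mathbb{R}_+u=\{\lambda u : \lambda\ge0\}$. $\mathbb{E}_2^\bullet:=\mathbb{E}_2\cup\{+\infty_\bullet\}$ with a formal largest element; $\mathrm{dom}\,F:=\{x : F(x)\in\mathbb{E}_2\}$, $\mathrm{rge}\,F:=F(\mathrm{dom}\,F)$, $\mathrm{gph}\,F:=\{(x,F(x)) : x\in\mathrm{dom}\,F\}$, $K\text{-}\mathrm{epi}\,F:=\{(x,y)\in\mathrm{dom}\,F\times\mathbb{E}_2 : y-F(x)\in K\}$. $F$ is proper if $\mathrm{dom}\,F\neq\emptyset$, $K$-convex (resp. $K$-closed) if $K\text{-}\mathrm{epi}\,F$ is convex (resp. closed in $\mathbb{E}_1\times\mathbb{E}_2$). $\overline{\mathrm{conv}}$ is the closed convex hull. $\langle u,F\rangle(x)=\langle u,F(x)\rangle$ for $x\in\mathrm{dom}\,F$ and $+\infty$ otherwise; $\delta_C$ is $0$ on $C$ and $+\infty$ elsewhere. For convex $C\subset\mathbb{E}_1$, $\Gamma_0(C)$ is the set of proper convex $f:\mathbb{E}_1\to\mathbb{R}\cup\{+\infty\}$ whose epigraph $\{(x,\alpha)\in\mathbb{E}_1\times\mathbb{R} : f(x)\le\alpha\}$ is closed in the subspace topology of $C\times\mathbb{R}$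 (for $\mathrm{dom}\,f=C$, as here: $\liminf_k f(x_k)\ge f(\bar x)$ whenever $x_k\in C$, $x_k\to\bar x\in C$). An affine majorant of $f$ on its domain is an affine function $\phi:\mathbb{E}_1\to\mathbb{R}$ with $f(x)\le\phi(x)$ for all $x\in\mathrm{dom}\,f:=\{x: f(x)<+\infty\}$. $\hat K_F$ is the closed convex cone with respect to which $F$ is convex and closed and which is contained in every other such closed convex cone. *)

theory Defs
  imports "HOL-Analysis.Analysis"
begin

text \<open>
  A function into the second space with a formal largest element adjoined is a partial function
  \<open>F :: 'a \<rightharpoonup> 'b\<close>, with \<^const>\<open>None\<close> as the largest element.  Domain, range and graph of such
  a function are then \<open>dom F\<close>, \<open>ran F\<close> and \<open>Map.graph F\<close>.
\<close>

definition polar_cone :: "'b::real_inner set \<Rightarrow> 'b set"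
  where "polar_cone K = {v. \<forall>u\<in>K. u \<bullet> v \<le> 0}"

definition K_epi :: "'b::ab_group_add set \<Rightarrow> ('a \<rightharpoonup> 'b) \<Rightarrow> ('a \<times> 'b) set"
  where "K_epi K F = {(x, y). x \<in> dom F \<and> y - the (F x) \<in> K}"

definition K_convex :: "'b::real_vector set \<Rightarrow> ('a::real_vector \<rightharpoonup> 'b) \<Rightarrow> bool"
  where "K_convex K F \<longleftrightarrow> convex (K_epi K F)"

definition K_closed :: "'b::real_normed_vector set \<Rightarrow> ('a::real_normed_vector \<rightharpoonup> 'b) \<Rightarrow> bool"
  where "K_closed K F \<longleftrightarrow> closed (K_epi K F)"

definition K_hat :: "('a::real_normed_vector \<rightharpoonup> 'b::real_normed_vector) \<Rightarrow> 'b set"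
  where "K_hat F = (LEAST K. closed K \<and> convex_cone K \<and> K_convex K F \<and> K_closed K F)"

text \<open>
  The least element above exists as soon as there is one closed convex cone of the required kind,
  namely as the intersection of all of them.
\<close>

lemma K_hat_least:
  fixes F :: "'a::real_normed_vector \<rightharpoonup> 'b::real_normed_vector"
  assumes "closed K" "convex_cone K" "K_convex K F" "K_closed K F"
  shows "closed (K_hat F)" "convex_cone (K_hat F)" "K_convex (K_hat F) F" "K_closed (K_hat F) F"
    and "K_hat F \<subseteq> K"
proof -
  define P where "P = (\<lambda>K. closed K \<and> convex_cone K \<and> K_convex K F \<and> K_closed K F)"
  define I where "I = \<Inter>{K. P K}"
  have PK: "P K" using assms by (simp add: P_def)
  have epi: "K_epi I F = (\<Inter>K\<in>{K. P K}. K_epi K F)"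
    using PK by (auto simp: K_epi_def I_def)
  have "P I"
    unfolding P_def
  proof (intro conjI)
    show "closed I" unfolding I_def by (auto simp: P_def)
    show "convex_cone I" unfolding I_def by (auto simp: P_def convex_cone_iff)
    show "K_convex I F" unfolding K_convex_def epi
      by (intro convex_INT) (auto simp: P_def K_convex_def)
    show "K_closed I F" unfolding K_closed_def epi
      by (intro closed_INT) (auto simp: P_def K_closed_def)
  qed
  moreover have least: "I \<subseteq> K'" if "P K'" for K' using that by (auto simp: I_def)
  ultimately have "K_hat F = I"
    unfolding K_hat_def P_def[symmetric] by (intro Least_equality) auto
  with \<open>P I\<close> least[OF PK] show "closed (K_hat F)" "convex_cone (K_hat F)"
    "K_convex (K_hat F) F" "K_closed (K_hat F) F" "K_hat F \<subseteq> K"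
    by (auto simp: P_def)
qed

definition scalarization :: "'b::real_inner \<Rightarrow> ('a \<rightharpoonup> 'b) \<Rightarrow> 'a \<Rightarrow> ereal"
  where "scalarization u F x = (case F x of None \<Rightarrow> \<infinity> | Some y \<Rightarrow> ereal (u \<bullet> y))"

definition indicator_delta :: "'a set \<Rightarrow> 'a \<Rightarrow> ereal"
  where "indicator_delta C x = (if x \<in> C then 0 else \<infinity>)"

definition edom :: "('a \<Rightarrow> ereal) \<Rightarrow> 'a set"
  where "edom f = {x. f x < \<infinity>}"

definition eepi :: "('a \<Rightarrow> ereal) \<Rightarrow> ('a \<times> real) set"
  where "eepi f = {(x, \<alpha>). f x \<le> ereal \<alpha>}"

text \<open>An extended-real-valued function is convex if its epigraph is.\<close>

definition Gamma0 :: "'a::real_normed_vector set \<Rightarrow> ('a \<Rightarrow> ereal) set"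
  where "Gamma0 C = {f. (\<forall>x. f x \<noteq> -\<infinity>) \<and> edom f \<noteq> {} \<and> convex (eepi f) \<and>
           closedin (top_of_set (C \<times> UNIV)) (eepi f)}"

definition affine_function :: "('a::real_vector \<Rightarrow> real) \<Rightarrow> bool"
  where "affine_function \<phi> \<longleftrightarrow> (\<exists>l c. linear l \<and> \<phi> = (\<lambda>x. l x + c))"

definition has_affine_majorant :: "('a::real_vector \<Rightarrow> ereal) \<Rightarrow> bool"
  where "has_affine_majorant f \<longleftrightarrow>
           (\<exists>\<phi>. affine_function \<phi> \<and> (\<forall>x\<in>edom f. f x \<le> ereal (\<phi> x)))"

end

theory Submission
  imports Defs
begin

text \<open>
  Everything rests on one separation argument.  The set \<open>K_epi K F\<close> is closed, convex and contains
  the graph of \<open>F\<close>, hence contains the closed convex hull of the graph.  If the hull missed a point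
  \<open>(x, F x + v)\<close> with \<open>v \<in> K\<close>, a hyperplane with normal \<open>(p, q)\<close> would bound \<open>p \<bullet> z + q \<bullet> F z\<close>
  from above by some \<open>c\<close> on the whole domain and separate that point, which forces \<open>q \<bullet> v > 0\<close>.
  As \<open>L\<close> generates \<open>K\<close>, some \<open>u \<in> L\<close> has \<open>q \<bullet> u > 0\<close> as well
  (lemma \<open>generator_positive\<close>).  On \<open>C u\<close> the values of \<open>F\<close> are nonnegative multiples \<open>t u\<close>, so the
  hyperplane reads \<open>t \<le> (c - p \<bullet> z) / (q \<bullet> u)\<close>: it bounds the scalarization
  \<open>u \<bullet> F z = t (u \<bullet> u)\<close> by an affine function, which is excluded
  (lemma \<open>hyperplane_imp_affine_majorant\<close>).

  Minimality of \<open>K\<close> follows because, for every closed convex cone \<open>M\<close> with respect to which \<open>F\<close> is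
  convex and closed, the hull of the graph also lies in \<open>K_epi M F\<close>.  Hence
  \<open>K_epi K F \<subseteq> K_epi M F\<close>, and comparing the fibres over one point of the domain gives
  \<open>K \<subseteq> M\<close>.
\<close>

lemma closed_convex_hull_graph_subset_K_epi:
  assumes "0 \<in> K" "K_convex K F" "K_closed K F"
  shows "closure (convex hull (Map.graph F)) \<subseteq> K_epi K F"
proof (intro closure_minimal hull_minimal)
  show "Map.graph F \<subseteq> K_epi K F"
    using assms(1) by (auto simp: Map.graph_def K_epi_def)
qed (use assms in \<open>simp_all add: K_convex_def K_closed_def\<close>)

lemma K_epi_mono_imp_subset:
  assumes "dom F \<noteq> {}" "K_epi K F \<subseteq> K_epi M F"
  shows "K \<subseteq> M"
proof
  fix v assume "v \<in> K"
  obtain x where "x \<in> dom F" using assms(1) by blast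
  with \<open>v \<in> K\<close> have "(x, the (F x) + v) \<in> K_epi K F" by (simp add: K_epi_def)
  with assms(2) have "(x, the (F x) + v) \<in> K_epi M F" by (rule subsetD)
  then show "v \<in> M" by (simp add: K_epi_def)
qed

text \<open>
  Otherwise the halfspace \<open>{w. q \<bullet> w \<le> 0}\<close>, itself a closed convex cone, would contain \<open>L\<close> and with
  it the closed cone generated by \<open>L\<close>.
\<close>

lemma generator_positive:
  fixes L :: "'b::real_inner set"
  assumes "v \<in> closure (convex_cone hull L)" "q \<bullet> v > 0"
  obtains u where "u \<in> L" "q \<bullet> u > 0"
proof -
  have "closure (convex_cone hull L) \<subseteq> {w. q \<bullet> w \<le> 0}" if "L \<subseteq> {w. q \<bullet> w \<le> 0}"
  proof (intro closure_minimal hull_minimal that)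
    show "convex_cone {w. q \<bullet> w \<le> 0}"
      by (auto simp: convex_cone_iff inner_add_right mult_nonneg_nonpos)
    show "closed {w. q \<bullet> w \<le> 0}" by (rule closed_halfspace_le)
  qed
  with assms that show ?thesis by (force simp: not_le)
qed

text \<open>
  The analytic core: along the ray of \<open>u\<close> the scalarization recovers the multiple \<open>t\<close> in \<open>F z = t u\<close>
  up to the factor \<open>u \<bullet> u\<close>, so a hyperplane that lies above the graph of \<open>F\<close> and is increasing in the
  direction \<open>u\<close> solves for an affine bound on it.
\<close>

lemma hyperplane_imp_affine_majorant:
  fixes F :: "'a::euclidean_space \<rightharpoonup> 'b::euclidean_space"
  assumes ray: "(\<lambda>x. the (F x)) ` C \<subseteq> {t *\<^sub>R u | t. t \<ge> 0}"
    and bound: "\<And>x y. F x = Some y \<Longrightarrow> p \<bullet> x + q \<bullet> y \<le> c"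
    and pos: "q \<bullet> u > 0"
  shows "has_affine_majorant (\<lambda>x. scalarization u F x + indicator_delta C x)"
proof -
  define s where "s = (u \<bullet> u) / (q \<bullet> u)"
  define \<phi> where "\<phi> = (\<lambda>x. - (s *\<^sub>R p) \<bullet> x + s * c)"
  have "linear (\<lambda>x. - (s *\<^sub>R p) \<bullet> x)"
    by (rule bounded_linear.linear[OF bounded_linear_inner_right])
  then have "affine_function \<phi>"
    unfolding affine_function_def \<phi>_def by blast
  moreover have "scalarization u F x + indicator_delta C x \<le> ereal (\<phi> x)"
    if "x \<in> edom (\<lambda>x. scalarization u F x + indicator_delta C x)" for x
  proof -
    from that obtain y where x: "x \<in> C" and y: "F x = Some y"
      by (auto simp: edom_def indicator_delta_def scalarization_def
          split: option.splits if_splits)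
    obtain t where t: "y = t *\<^sub>R u" using ray x y by force
    have "t * (q \<bullet> u) \<le> c - p \<bullet> x"
      using bound[OF y] by (simp add: t)
    moreover have "s \<ge> 0" using pos by (simp add: s_def)
    ultimately have "s * (t * (q \<bullet> u)) \<le> s * (c - p \<bullet> x)"
      by (rule mult_left_mono)
    moreover have "s * (t * (q \<bullet> u)) = u \<bullet> y"
      using pos by (simp add: s_def t)
    ultimately have "u \<bullet> y \<le> \<phi> x"
      by (simp add: \<phi>_def algebra_simps)
    then show ?thesis using x y by (simp add: scalarization_def indicator_delta_def)
  qed
  ultimately show ?thesis unfolding has_affine_majorant_def by blast
qed

lemma K_epi_subset_closed_convex_hull_graph:
  fixes F :: "'a::euclidean_space \<rightharpoonup> 'b::euclidean_space"
  assumes gen: "K \<subseteq> closure (convex_cone hull L)"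
    and ray: "\<And>u. u \<in> L \<Longrightarrow> (\<lambda>x. the (F x)) ` C u \<subseteq> {t *\<^sub>R u | t. t \<ge> 0}"
    and nomaj: "\<And>u. u \<in> L \<Longrightarrow>
           \<not> has_affine_majorant (\<lambda>x. scalarization u F x + indicator_delta (C u) x)"
  shows "K_epi K F \<subseteq> closure (convex hull (Map.graph F))"
proof (rule ccontr)
  let ?T = "closure (convex hull (Map.graph F))"
  assume "\<not> K_epi K F \<subseteq> ?T"
  then obtain x y0 v where xy: "F x = Some y0" and v: "v \<in> K" and notin: "(x, y0 + v) \<notin> ?T"
    by (force simp: K_epi_def)
  obtain a b where sep: "a \<bullet> (x, y0 + v) < b" "\<And>z. z \<in> ?T \<Longrightarrow> a \<bullet> z > b"
    using separating_hyperplane_closed_point[OF convex_closure[OF convex_convex_hull] closed_closure notin]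
    by metis
  \<comment> \<open>Change of sign, so that the graph lies below the hyperplane.\<close>
  define p q c where "p = - fst a" and "q = - snd a" and "c = - b"
  have "a = (- p, - q)" by (simp add: p_def q_def)
  note sep = sep[unfolded this]
  have bound: "p \<bullet> z + q \<bullet> y \<le> c" if "F z = Some y" for z y
  proof -
    have "(z, y) \<in> ?T"
      using that by (intro closure_subset[THEN subsetD] hull_inc) (simp add: Map.graph_def)
    from sep(2)[OF this] show ?thesis by (simp add: c_def)
  qed
  have "q \<bullet> v > 0"
    using sep(1) bound[OF xy] by (simp add: c_def inner_add_right)
  then obtain u where u: "u \<in> L" "q \<bullet> u > 0"
    using generator_positive v gen by blast
  show False
    using nomaj[OF u(1)] hyperplane_imp_affine_majorant[OF ray[OF u(1)] bound u(2)] by blast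
qed

theorem lemma45:
  fixes K :: "'b::euclidean_space set"
    and F :: "'a::euclidean_space \<rightharpoonup> 'b"
    and L :: "'b set"
    and C :: "'b \<Rightarrow> 'a set"
  assumes "convex_cone K" and "closed K" and "K \<noteq> {0}"
    and "K \<subseteq> uminus ` polar_cone K"
    and "dom F \<noteq> {}" and "K_closed K F" and "K_convex K F"
    and "L \<noteq> {}" and "L \<subseteq> K \<inter> ran F" and "closure (convex_cone hull L) = K"
    and "\<And>u. u \<in> L \<Longrightarrow> convex (C u)"
    and "\<And>u. u \<in> L \<Longrightarrow> C u \<subseteq> dom F"
    and "\<And>u. u \<in> L \<Longrightarrow> (\<lambda>x. the (F x)) ` C u \<subseteq> {t *\<^sub>R u | t. t \<ge> 0}"
    and "\<And>u. u \<in> L \<Longrightarrow> (\<lambda>x. scalarization u F x + indicator_delta (C u) x) \<in> Gamma0 (C u)"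
    and "\<And>u. u \<in> L \<Longrightarrow>
           \<not> has_affine_majorant (\<lambda>x. scalarization u F x + indicator_delta (C u) x)"
  shows "K_epi K F = closure (convex hull (Map.graph F)) \<and> K = K_hat F"
proof
  have "0 \<in> K" using assms(1) by (rule convex_cone_contains_0)
  show epi: "K_epi K F = closure (convex hull (Map.graph F))"
  proof
    show "K_epi K F \<subseteq> closure (convex hull (Map.graph F))"
      by (rule K_epi_subset_closed_convex_hull_graph[OF _ assms(13,15)]) (simp_all add: assms(10))
    show "closure (convex hull (Map.graph F)) \<subseteq> K_epi K F"
      using \<open>0 \<in> K\<close> assms(6,7) by (intro closed_convex_hull_graph_subset_K_epi)
  qed
  note hat = K_hat_least[OF assms(2,1,7,6)]
  have "K_epi K F \<subseteq> K_epi (K_hat F) F"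
    unfolding epi using convex_cone_contains_0[OF hat(2)] hat(3,4)
    by (intro closed_convex_hull_graph_subset_K_epi)
  then have "K \<subseteq> K_hat F"
    by (rule K_epi_mono_imp_subset[OF assms(5)])
  with hat(5) show "K = K_hat F" by blast
qed

end
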